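(* Let $E$ be a nonzero reflexive real Banach space and let $f,g\colon E\times E^*\to\,]{-}\infty,\infty]$ be proper convex lower semicontinuous BC--functions. Then $\mathrm{dom}\,f+\rho_1\mathrm{dom}\,g=E\times E^*\iff{\cal P}_q(f)+\rho_1{\cal P}_q(g)=E\times E^*$, and $\mathrm{dom}\,f-\rho_1\mathrm{dom}\,g=E\times E^*\iff{\cal P}_q(f)-\rho_1{\cal P}_q(g)=E\times E^*$.
   Context: $\rho_1(x,x^* ):=(-x,x^* )$. $\mathrm{dom}\,f:=\{(x,x^* )\colon f(x,x^* )\in\mathbb{R}\}$. On $E\times E^*$ set $\lfloor(x,x^* ),(y,y^* )\rfloor:=\langle x,y^*\rangle+\langle y,x^*\rangle$ and $q(x,x^* ):=\langle x,x^*\rangle$. For $k$ on $E\times E^*$, $k^@(y,y^* ):=\sup_{(x,x^* )}[\lfloor(x,x^* ),(y,y^* )\rfloor-k(x,x^* )]$; a BC--function is a proper convex $k$ with $k^@\ge k\ge q$; ${\cal P}_q(k):=\{(x,x^* )\colon k(x,x^* )=\langle x,x^*\rangle\}$. *)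

theory Defs
  imports "HOL-Analysis.Analysis"
begin

definition reflexive_space :: "'a::real_normed_vector itself \<Rightarrow> bool" where
  "reflexive_space _ \<longleftrightarrow>
     (\<forall>\<Phi> :: ('a \<Rightarrow>\<^sub>L real) \<Rightarrow>\<^sub>L real. \<exists>x::'a. \<forall>\<phi>. blinfun_apply \<Phi> \<phi> = blinfun_apply \<phi> x)"

type_synonym 'a pd = "'a \<times> ('a \<Rightarrow>\<^sub>L real)"

definition qf :: "'a::real_normed_vector pd \<Rightarrow> real" where
  "qf p = blinfun_apply (snd p) (fst p)"

definition bracket :: "'a::real_normed_vector pd \<Rightarrow> 'a pd \<Rightarrow> real" where
  "bracket p r = blinfun_apply (snd r) (fst p) + blinfun_apply (snd p) (fst r)"

definition fenchel_at :: "('a::real_normed_vector pd \<Rightarrow> ereal) \<Rightarrow> 'a pd \<Rightarrow> ereal" where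
  "fenchel_at k r = (SUP p. ereal (bracket p r) - k p)"

definition rho1 :: "'a::real_normed_vector pd \<Rightarrow> 'a pd" where
  "rho1 p = (- fst p, snd p)"

definition proper_fun :: "('b \<Rightarrow> ereal) \<Rightarrow> bool" where
  "proper_fun k \<longleftrightarrow> (\<forall>p. k p \<noteq> -\<infinity>) \<and> (\<exists>p. k p \<noteq> \<infinity>)"

definition convex_fun :: "('b::real_vector \<Rightarrow> ereal) \<Rightarrow> bool" where
  "convex_fun k \<longleftrightarrow> convex {(p, t::real). k p \<le> ereal t}"

definition lsc_fun :: "('b::topological_space \<Rightarrow> ereal) \<Rightarrow> bool" where
  "lsc_fun k \<longleftrightarrow> (\<forall>c::real. closed {p. k p \<le> ereal c})"

definition BC_function :: "('a::real_normed_vector pd \<Rightarrow> ereal) \<Rightarrow> bool" where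
  "BC_function k \<longleftrightarrow> proper_fun k \<and> convex_fun k \<and>
     (\<forall>p. ereal (qf p) \<le> k p) \<and> (\<forall>p. k p \<le> fenchel_at k p)"

definition dom_fun :: "('b \<Rightarrow> ereal) \<Rightarrow> 'b set" where
  "dom_fun k = {p. \<exists>r. k p = ereal r}"

definition Pq :: "('a::real_normed_vector pd \<Rightarrow> ereal) \<Rightarrow> 'a pd set" where
  "Pq k = {p. k p = ereal (qf p)}"

definition msum :: "'b::ab_group_add set \<Rightarrow> 'b set \<Rightarrow> 'b set" where
  "msum A B = {a + b | a b. a \<in> A \<and> b \<in> B}"

definition mdiff :: "'b::ab_group_add set \<Rightarrow> 'b set \<Rightarrow> 'b set" where
  "mdiff A B = {a - b | a b. a \<in> A \<and> b \<in> B}"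

end

theory Submission
  imports Defs
begin

text \<open>
  Write \<open>[b, c]\<close> for the bracket. As \<open>\<rho>\<^sub>1\<close> is an involution reversing the signs of \<open>q\<close> and of the bracket,
  \<open>q b + q (\<rho>\<^sub>1 (c - b)) = [b, c] - q c\<close>; hence \<open>f b + g d \<ge> [b, c] - q c\<close> whenever
  \<open>b + \<rho>\<^sub>1 d = c\<close>. If \<open>dom f + \<rho>\<^sub>1 dom g\<close> is the whole space, Fenchel duality (Hahn--Banach for
  the value function, continuity of the functional by Baire category and an open mapping argument) and
  reflexivity give a point \<open>a\<close> with \<open>f\<^sup>@ a + g\<^sup>@ (\<rho>\<^sub>1 (c - a)) \<le> [a, c] - q c\<close>. Since
  \<open>f\<^sup>@ \<ge> f \<ge> q\<close> and \<open>g\<^sup>@ \<ge> g \<ge> q\<close>, the identity forces equality throughout, so \<open>a\<close> and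
  \<open>\<rho>\<^sub>1 (c - a)\<close> lie in the two coincidence sets. The statement for differences follows by applying this
  to \<open>p \<mapsto> g (- p)\<close>.
\<close>

section \<open>Hahn-Banach domination below a convex set\<close>

text \<open>A slope \<open>\<alpha>\<close> in direction \<open>v\<close> has to lie above the
  quotients in \<open>A\<close>, which come from points \<open>m - r *\<^sub>R v\<close>, and below
  those coming from \<open>m' + r' *\<^sub>R v\<close>. Convexity of \<open>K\<close> makes the two
  families compatible, so \<open>Sup A\<close> works.\<close>

lemma hahn_banach_step:
  fixes K H :: "('a::real_vector \<times> real) set"
  assumes K: "convex K" and total: "\<And>z. \<exists>t. (z, t) \<in> K"
    and H: "subspace H" and le: "\<And>z s t. (z, s) \<in> H \<Longrightarrow> (z, t) \<in> K \<Longrightarrow> s \<le> t"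
  obtains \<alpha> where "\<And>z s t. (z, s) \<in> span (insert (v, \<alpha>) H) \<Longrightarrow> (z, t) \<in> K \<Longrightarrow> s \<le> t"
proof -
  define A where "A = {(s - t) / r | m s r t. (m, s) \<in> H \<and> r > 0 \<and> (m - r *\<^sub>R v, t) \<in> K}"
  have cross: "(s - t) / r \<le> (t' - s') / r'"
    if "(m, s) \<in> H" "r > 0" "(m - r *\<^sub>R v, t) \<in> K" "(m', s') \<in> H" "r' > 0" "(m' + r' *\<^sub>R v, t') \<in> K"
    for m s r t m' s' r' t'
  proof -
    \<comment> \<open>Since \<open>u * r = w * r'\<close>, the multiples of \<open>v\<close> cancel
      in the convex combination, which leaves a point where domination of \<open>H\<close>
      applies.\<close>
    define u where "u = r' / (r + r')"
    define w where "w = r / (r + r')"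
    have uw: "u \<ge> 0" "w \<ge> 0" "u + w = 1" "u * r = w * r'"
      using that by (auto simp: u_def w_def divide_simps)
    have "u *\<^sub>R (m - r *\<^sub>R v, t) + w *\<^sub>R (m' + r' *\<^sub>R v, t') \<in> K"
      using K that uw unfolding convex_def by blast
    moreover have "u *\<^sub>R (m - r *\<^sub>R v, t) + w *\<^sub>R (m' + r' *\<^sub>R v, t') = (u *\<^sub>R m + w *\<^sub>R m', u * t + w * t')"
      using uw(4) by (simp add: algebra_simps)
    moreover have "u *\<^sub>R (m, s) + w *\<^sub>R (m', s') \<in> H"
      using H that by (meson subspace_add subspace_scale)
    ultimately have "u * s + w * s' \<le> u * t + w * t'"
      using le by simp
    then have "r' * s + r * s' \<le> r' * t + r * t'"
      using that by (simp add: u_def w_def divide_simps)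
    then show ?thesis
      using that by (simp add: divide_simps) (simp add: algebra_simps)
  qed
  have H0: "(0, 0) \<in> H"
    using subspace_0[OF H] by (simp add: zero_prod_def)
  \<comment> \<open>A point of \<open>K\<close> over \<open>v\<close> bounds \<open>A\<close> from
    above; one over \<open>- v\<close> makes \<open>A\<close> nonempty.\<close>
  obtain t1 where t1: "(0 + 1 *\<^sub>R v, t1) \<in> K"
    using total by blast
  obtain t2 where t2: "(0 - 1 *\<^sub>R v, t2) \<in> K"
    using total by blast
  have A_ne: "A \<noteq> {}"
    using H0 t2 zero_less_one[where ?'a = real] unfolding A_def by blast
  have A_bdd: "bdd_above A"
    unfolding A_def bdd_above_def using cross[OF _ _ _ H0 _ t1] by (auto intro!: exI[of _ "(t1 - 0)/1"])
  have "s \<le> t" if "(z, s) \<in> span (insert (v, Sup A) H)" and t: "(z, t) \<in> K" for z s t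
  proof -
    from that obtain k where "(z, s) - k *\<^sub>R (v, Sup A) \<in> span H"
      by (auto simp: span_breakdown_eq)
    then have h: "(z - k *\<^sub>R v, s - k * Sup A) \<in> H"
      using H by (simp add: span_eq_iff[THEN iffD2])
    \<comment> \<open>For \<open>k > 0\<close> it matters that \<open>Sup A\<close> is the least
      upper bound, for \<open>k < 0\<close> that it is an upper bound.\<close>
    consider "k = 0" | "k > 0" | "k < 0" by linarith
    then show ?thesis
    proof cases
      case 1 then show ?thesis using h le t by simp
    next
      case 2
      have "Sup A \<le> (t - (s - k * Sup A)) / k"
        by (rule cSup_least[OF A_ne]) (use cross h 2 t in \<open>auto simp: A_def\<close>)
      then show ?thesis using 2 by (simp add: divide_simps algebra_simps)
    next
      case 3
      have "((s - k * Sup A) - t) / (- k) \<in> A"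
        unfolding A_def[THEN eqset_imp_iff]
      proof (intro CollectI exI conjI)
        show "(z - k *\<^sub>R v, s - k * Sup A) \<in> H" by (rule h)
        show "(z - k *\<^sub>R v - (- k) *\<^sub>R v, t) \<in> K" using t by simp
      qed (use 3 in simp_all)
      then have "((s - k * Sup A) - t) / (- k) \<le> Sup A"
        by (rule cSup_upper[OF _ A_bdd])
      then show ?thesis using 3 by (simp add: divide_simps algebra_simps)
    qed
  qed
  then show thesis by (rule that)
qed

text \<open>Zorn's lemma is applied to graphs of partial functionals. A subspace dominated by \<open>K\<close> is
  automatically single-valued, because \<open>K\<close> has a point above \<open>0\<close>.\<close>

lemma hahn_banach_convex:
  fixes K :: "('a::real_vector \<times> real) set"
  assumes K: "convex K" and total: "\<And>z. \<exists>t. (z, t) \<in> K"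
    and zero: "\<And>t. (0, t) \<in> K \<Longrightarrow> 0 \<le> t"
  obtains L where "linear L" "\<And>z t. (z, t) \<in> K \<Longrightarrow> L z \<le> t"
proof -
  define \<H> where "\<H> = {H. subspace H \<and> (\<forall>z s t. (z, s) \<in> H \<longrightarrow> (z, t) \<in> K \<longrightarrow> s \<le> t)}"
  have "{0} \<in> \<H>"
    using zero by (simp add: \<H>_def subspace_single_0) (auto simp: zero_prod_def)
  moreover have "\<Union>\<C> \<in> \<H>" if "\<C> \<noteq> {}" and ch: "subset.chain \<H> \<C>" for \<C>
  proof -
    have sub: "\<And>H. H \<in> \<C> \<Longrightarrow> subspace H"
      and le: "\<And>H z s t. H \<in> \<C> \<Longrightarrow> (z, s) \<in> H \<Longrightarrow> (z, t) \<in> K \<Longrightarrow> s \<le> t"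
      using ch by (auto simp: subset.chain_def \<H>_def)
    have "subspace (\<Union>\<C>)"
    proof (rule subspaceI)
      show "0 \<in> \<Union>\<C>" using \<open>\<C> \<noteq> {}\<close> sub subspace_0 by blast
      show "c *\<^sub>R x \<in> \<Union>\<C>" if "x \<in> \<Union>\<C>" for c x
        using that sub subspace_scale by blast
      show "x + y \<in> \<Union>\<C>" if xy: "x \<in> \<Union>\<C>" "y \<in> \<Union>\<C>" for x y
      proof -
        obtain X Y where XY: "X \<in> \<C>" "x \<in> X" "Y \<in> \<C>" "y \<in> Y" using xy by blast
        then have "X \<subseteq> Y \<or> Y \<subseteq> X" using ch by (auto simp: subset.chain_def)
        then show ?thesis using XY sub subspace_add by blast
      qed
    qed
    then show ?thesis using le by (auto simp: \<H>_def)
  qed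
  ultimately obtain M where M: "M \<in> \<H>" and max: "\<And>X. X \<in> \<H> \<Longrightarrow> M \<subseteq> X \<Longrightarrow> X = M"
    using subset_Zorn_nonempty[of \<H>] by (metis empty_iff)
  have subM: "subspace M" and leM: "\<And>z s t. (z, s) \<in> M \<Longrightarrow> (z, t) \<in> K \<Longrightarrow> s \<le> t"
    using M by (auto simp: \<H>_def)
  have ex: "\<exists>s. (v, s) \<in> M" for v
  proof -
    obtain \<alpha> where \<alpha>: "\<And>z s t. (z, s) \<in> span (insert (v, \<alpha>) M) \<Longrightarrow> (z, t) \<in> K \<Longrightarrow> s \<le> t"
      using hahn_banach_step[OF K total subM, of v] leM by blast
    then have "span (insert (v, \<alpha>) M) = M"
      by (intro max) (auto simp: \<H>_def intro: span_base)
    then show ?thesis by (metis insertI1 span_base)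
  qed
  have zero_unique: "s = 0" if "(0, s) \<in> M" for s
  proof (rule ccontr)
    assume "s \<noteq> 0"
    obtain t where t: "(0, t) \<in> K" using total by blast
    have "((t + 1) / s) *\<^sub>R (0, s) \<in> M" using subM that subspace_scale by blast
    then have "t + 1 \<le> t" using leM[OF _ t, of "t + 1"] \<open>s \<noteq> 0\<close> by simp
    then show False by simp
  qed
  have uniq: "s = s'" if "(v, s) \<in> M" "(v, s') \<in> M" for v s s'
    using subspace_diff[OF subM that] zero_unique by fastforce
  obtain L where L: "\<And>v. (v, L v) \<in> M" using ex by metis
  have "linear L"
  proof (rule linearI)
    show "L (x + y) = L x + L y" for x y
      using uniq[OF L] subspace_add[OF subM L L] by (metis add_Pair)
    show "L (c *\<^sub>R x) = c *\<^sub>R L x" for c x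
      using uniq[OF L] subspace_scale[OF subM L] by (metis scaleR_Pair)
  qed
  then show thesis using that L leM by blast
qed

section \<open>Continuity, open mapping and Baire category\<close>

text \<open>Linearity moves the bound to a ball around the origin, whose symmetry turns it into a
  bound on the absolute value.\<close>

lemma linear_bounded_above_on_ball:
  fixes L :: "'a::real_normed_vector \<Rightarrow> real"
  assumes L: "linear L" and r: "r > 0" and le: "\<And>z. z \<in> ball z0 r \<Longrightarrow> L z \<le> M"
  shows "bounded_linear L"
proof -
  define B where "B = M - L z0"
  have B: "L w \<le> B" if "norm w < r" for w
    using le[of "z0 + w"] that by (simp add: B_def linear_add[OF L] dist_norm)
  have "norm (L x) \<le> norm x * (B * 2 / r)" for x
  proof (cases "x = 0")
    case True then show ?thesis by (simp add: linear_0[OF L])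
  next
    case False
    define c where "c = r / (2 * norm x)"
    have c: "c > 0" "norm (c *\<^sub>R x) < r" using False r by (auto simp: c_def)
    have "c * L x \<le> B" "- (c * L x) \<le> B"
      using B[of "c *\<^sub>R x"] B[of "- (c *\<^sub>R x)"] c
      by (simp_all add: linear_scale[OF L] linear_neg[OF L])
    then have "c * \<bar>L x\<bar> \<le> B" using c(1) by (simp add: abs_if)
    then show ?thesis using False r by (simp add: c_def field_simps)
  qed
  then show ?thesis
    by (intro bounded_linear_intro[where K = "B * 2 / r"] linear_add[OF L] linear_scale[OF L])
qed

text \<open>The open mapping argument: the points chosen along the way are averaged with weights
  \<open>2\<^sup>-\<^sup>n\<close>, so the limit stays in the closed convex set.\<close>

lemma closed_convex_image_ball:
  fixes T :: "'b::banach \<Rightarrow> 'a::real_normed_vector"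
  assumes T: "bounded_linear T" and C: "closed C" "convex C" "bounded C" "0 \<in> C"
    and r: "r > 0" and dense: "ball 0 r \<subseteq> closure (T ` C)"
  shows "ball 0 (r / 2) \<subseteq> T ` C"
proof
  interpret T: bounded_linear T by (rule T)
  fix w assume w: "w \<in> ball (0::'a) (r / 2)"
  \<comment> \<open>Doubling keeps \<open>u\<close> inside the ball of radius \<open>r\<close>,
    where approximation is possible, and the new error is again below \<open>r / 2\<close>. Hence
    the halved radius in the conclusion.\<close>
  define P where "P u c \<longleftrightarrow> c \<in> C \<and> norm (2 *\<^sub>R u - T c) < r / 2" for u c
  have "\<exists>c. P u c" if "norm u < r / 2" for u
  proof -
    have "2 *\<^sub>R u \<in> closure (T ` C)" using dense that by (auto intro!: subsetD[OF dense])
    then obtain y where "y \<in> T ` C" "dist y (2 *\<^sub>R u) < r / 2"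
      using r by (meson closure_approachable half_gt_zero)
    then show ?thesis by (auto simp: P_def dist_norm norm_minus_commute)
  qed
  then obtain ch where ch: "\<And>u. norm u < r / 2 \<Longrightarrow> P u (ch u)" by metis
  \<comment> \<open>\<open>u n\<close> is the error after \<open>n\<close> terms scaled up by
    \<open>2^n\<close>; as it stays bounded, the true error tends to 0.\<close>
  define u where "u = rec_nat w (\<lambda>_ v. 2 *\<^sub>R v - T (ch v))"
  have u0: "u 0 = w" and uS: "\<And>n. u (Suc n) = 2 *\<^sub>R u n - T (ch (u n))"
    by (simp_all add: u_def)
  have un: "norm (u n) < r / 2" for n
    by (induction n) (use w ch in \<open>auto simp: u0 uS P_def\<close>)
  have chC: "ch (u n) \<in> C" for n using ch[OF un] by (simp add: P_def)
  define a where "a n = (1/2) ^ Suc n *\<^sub>R ch (u n)" for n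
  obtain B where B: "\<And>c. c \<in> C \<Longrightarrow> norm c \<le> B" using C(3) by (auto simp: bounded_iff)
  have "summable a"
  proof (rule summable_comparison_test')
    show "summable (\<lambda>n. (1/2) ^ Suc n * B)"
      by (intro summable_mult2) (simp add: summable_mult summable_geometric)
    show "norm (a n) \<le> (1/2) ^ Suc n * B" for n
      using B[OF chC] by (simp add: a_def)
  qed
  then have lim: "(\<lambda>n. \<Sum>i<n. a i) \<longlonglongrightarrow> suminf a" by (rule summable_LIMSEQ)
  \<comment> \<open>The first \<open>n\<close> weights add up to \<open>1 - (1/2)^n\<close>; for
    \<open>n = 0\<close> this is 0 and any point of \<open>C\<close> serves.\<close>
  have part: "(\<Sum>i<n. a i) \<in> (\<lambda>c. (1 - (1/2)^n) *\<^sub>R c) ` C" for n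
  proof (induction n)
    case 0 show ?case using C(4) by force
  next
    case (Suc n)
    then obtain c where c: "c \<in> C" "(\<Sum>i<n. a i) = (1 - (1/2)^n) *\<^sub>R c" by blast
    define s where "s = (1 - (1/2::real)^Suc n)"
    have half: "(1/2::real)^n \<le> 1" by (simp add: power_le_one)
    then have s: "s > 0" "(1/2::real)^n \<le> 1" by (simp_all add: s_def)
    have "((1 - (1/2)^n) / s) *\<^sub>R c + ((1/2)^Suc n / s) *\<^sub>R ch (u n) \<in> C"
      by (rule convexD[OF C(2) c(1) chC]) (use s in \<open>auto simp: s_def divide_simps\<close>)
    moreover have "s *\<^sub>R (((1 - (1/2)^n) / s) *\<^sub>R c + ((1/2)^Suc n / s) *\<^sub>R ch (u n)) = (\<Sum>i<Suc n. a i)"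
      using s c by (simp add: scaleR_add_right a_def)
    ultimately show ?case unfolding s_def by (metis image_eqI)
  qed
  \<comment> \<open>The missing weight \<open>(1/2)^n\<close> is put on
    \<open>0 \<in> C\<close>.\<close>
  have inC: "(\<Sum>i<n. a i) \<in> C" for n
  proof -
    obtain c where c: "c \<in> C" "(\<Sum>i<n. a i) = (1 - (1/2)^n) *\<^sub>R c" using part by blast
    have "(1 - (1/2)^n) *\<^sub>R c + ((1/2)^n) *\<^sub>R 0 \<in> C"
      by (rule convexD[OF C(2) c(1) C(4)]) (auto simp: power_le_one)
    then show ?thesis using c by simp
  qed
  have "suminf a \<in> C"
    using C(1) lim inC by (metis closed_sequentially)
  moreover have "T (suminf a) = w"
  proof (rule LIMSEQ_unique)
    show "(\<lambda>n. T (\<Sum>i<n. a i)) \<longlonglongrightarrow> T (suminf a)" by (rule T.tendsto[OF lim])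
    have eq: "T (\<Sum>i<n. a i) = w - (1/2)^n *\<^sub>R u n" for n
      by (induction n) (simp_all add: u0 uS a_def T.add T.scaleR T.zero scaleR_diff_right)
    have "(\<lambda>n. (1/2)^n *\<^sub>R u n) \<longlonglongrightarrow> 0"
    proof (rule Lim_null_comparison)
      show "\<forall>\<^sub>F n in sequentially. norm ((1/2)^n *\<^sub>R u n) \<le> (1/2)^n * (r/2)"
        using un by (auto intro!: always_eventually mult_left_mono less_imp_le)
      show "(\<lambda>n. (1/2)^n * (r/2)) \<longlonglongrightarrow> 0"
        by (intro tendsto_mult_left_zero LIMSEQ_power_zero) simp
    qed
    from tendsto_diff[OF tendsto_const[of w] this]
    show "(\<lambda>n. T (\<Sum>i<n. a i)) \<longlonglongrightarrow> w" by (simp add: eq)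
  qed
  ultimately show "w \<in> T ` C" by blast
qed

lemma baire_closed_cover:
  fixes F :: "nat \<Rightarrow> 'a::{complete_space} set"
  assumes "\<And>n. closed (F n)" and "(\<Union>n. F n) = UNIV"
  obtains n where "interior (F n) \<noteq> {}"
proof -
  have "completely_metrizable_space (euclidean :: 'a topology)"
    by (metis Met_TC.completely_metrizable_space_mtopology complete_UNIV mcomplete_iff_complete mtopology_is_euclidean)
  then have "\<exists>n. interior (F n) \<noteq> {}"
    using Baire_category_alt[of "euclidean :: 'a topology" "range F"] assms by auto
  then show thesis using that by blast
qed

text \<open>By Baire, the closure of one image has interior. Recentring at a point of that image
  reduces to \<open>closed_convex_image_ball\<close>, which removes the closure at the cost of half
  the radius.\<close>

lemma closed_convex_cover_ball:
  fixes T :: "'b::banach \<Rightarrow> 'a::banach" and S :: "nat \<Rightarrow> 'b set"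
  assumes T: "bounded_linear T"
    and S: "\<And>n. closed (S n)" "\<And>n. convex (S n)" "\<And>n. bounded (S n)"
    and cover: "(\<Union>n. T ` S n) = UNIV"
  obtains n z r where "r > 0" "ball z r \<subseteq> T ` S n"
proof -
  interpret T: bounded_linear T by (rule T)
  have "(\<Union>n. closure (T ` S n)) = UNIV"
    using cover UN_mono[OF subset_refl closure_subset] by (metis top.extremum_uniqueI)
  then obtain n where n: "interior (closure (T ` S n)) \<noteq> {}"
    using baire_closed_cover[of "\<lambda>n. closure (T ` S n)", OF closed_closure] by metis
  \<comment> \<open>The centre has to come from the image itself and not just its closure, so that
    the translate \<open>C\<close> contains 0.\<close>
  then have "interior (closure (T ` S n)) \<inter> T ` S n \<noteq> {}"
    using open_Int_closure_eq_empty[OF open_interior, of "closure (T ` S n)" "T ` S n"] interior_subset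
    by blast
  then obtain c r where c: "c \<in> S n" and r: "r > 0" "ball (T c) r \<subseteq> closure (T ` S n)"
    by (auto simp: mem_interior)
  define C where "C = (\<lambda>x. - c + x) ` S n"
  have TC: "T ` C = (\<lambda>x. - T c + x) ` T ` S n"
    by (simp add: C_def image_image T.diff)
  have "ball 0 (r / 2) \<subseteq> T ` C"
  proof (rule closed_convex_image_ball[OF T])
    show "closed C" "convex C" "bounded C" "0 \<in> C"
      unfolding C_def using S c
      by (blast intro: closed_translation convex_translation bounded_translation image_eqI[of _ _ c]
          left_minus[symmetric])+
    have "ball 0 r = (\<lambda>x. - T c + x) ` ball (T c) r"
      using ball_translation[of "- T c" "T c" r] by simp
    then show "ball 0 r \<subseteq> closure (T ` C)"
      unfolding TC closure_translation using r(2) by blast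
  qed (use r in simp)
  then have "(\<lambda>x. T c + x) ` ball 0 (r / 2) \<subseteq> T ` S n"
    by (force simp: TC)
  then have "ball (T c) (r / 2) \<subseteq> T ` S n"
    using ball_translation[of "T c" 0 "r / 2"] by simp
  then show thesis using that r by (meson half_gt_zero)
qed

section \<open>Fenchel duality for the bracket\<close>

lemma bounded_linear_bracket: "bounded_linear (\<lambda>p. bracket p r)"
proof -
  have "bounded_linear (\<lambda>p::'a::real_normed_vector pd. blinfun_apply (snd r) (fst p))"
    by (intro bounded_linear_compose[OF blinfun.bounded_linear_right bounded_linear_fst])
  moreover have "bounded_linear (\<lambda>p::'a pd. blinfun_apply (snd p) (fst r))"
    by (intro bounded_linear_compose[OF blinfun.bounded_linear_left bounded_linear_snd])
  ultimately show ?thesis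
    unfolding bracket_def by (rule bounded_linear_add)
qed

lemma bounded_linear_rho1: "bounded_linear rho1"
  unfolding rho1_def by (intro bounded_linear_Pair bounded_linear_minus bounded_linear_fst bounded_linear_snd)

text \<open>The restriction of \<open>L\<close> to the first factor is an element of the dual; the
  restriction to the second lies in the bidual and is evaluation at a point by reflexivity.\<close>

lemma reflexive_bracket_representation:
  fixes L :: "'a::real_normed_vector pd \<Rightarrow> real"
  assumes "reflexive_space TYPE('a)" and L: "bounded_linear L"
  obtains a where "\<And>p. L p = bracket p a"
proof -
  have L1: "bounded_linear (\<lambda>x. L (x, 0))"
    by (intro bounded_linear_compose[OF L] bounded_linear_Pair bounded_linear_ident bounded_linear_zero)
  have L2: "bounded_linear (\<lambda>\<xi>. L (0, \<xi>))"
    by (intro bounded_linear_compose[OF L] bounded_linear_Pair bounded_linear_ident bounded_linear_zero)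
  obtain x where x: "\<And>\<xi>. blinfun_apply (Blinfun (\<lambda>\<xi>. L (0, \<xi>))) \<xi> = blinfun_apply \<xi> x"
    using assms(1) unfolding reflexive_space_def by blast
  have "L p = bracket p (x, Blinfun (\<lambda>x. L (x, 0)))" for p
  proof -
    have "L p = L (fst p, 0) + L (0, snd p)"
      using linear_add[OF bounded_linear.linear[OF L], of "(fst p, 0)" "(0, snd p)"] by simp
    then show ?thesis
      using x[of "snd p"] by (simp add: bracket_def bounded_linear_Blinfun_apply L1 L2)
  qed
  then show thesis by (rule that)
qed

lemma convex_fun_sublevel:
  assumes "convex_fun k"
  shows "convex {p. k p \<le> ereal c}"
proof (rule convexI)
  fix x y and u v :: real
  assume xy: "x \<in> {p. k p \<le> ereal c}" "y \<in> {p. k p \<le> ereal c}" and uv: "0 \<le> u" "0 \<le> v" "u + v = 1"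
  have "u *\<^sub>R (x, c) + v *\<^sub>R (y, c) \<in> {(p, t). k p \<le> ereal t}"
    using assms xy uv unfolding convex_fun_def by (intro convexD) auto
  moreover have "u * c + v * c = c" using uv(3) by (metis distrib_right mult_1)
  ultimately show "u *\<^sub>R x + v *\<^sub>R y \<in> {p. k p \<le> ereal c}" by simp
qed

text \<open>Where \<open>k p\<close> is infinite the supremum receives \<open>-\<infinity>\<close>,
  so real upper bounds \<open>s\<close> of \<open>k p\<close> suffice and estimates stay in the
  reals.\<close>

lemma fenchel_at_le:
  assumes "\<And>p. k p \<noteq> -\<infinity>" and "\<And>p s. k p \<le> ereal s \<Longrightarrow> bracket p r - s \<le> m"
  shows "fenchel_at k r \<le> ereal m"
  unfolding fenchel_at_def
proof (rule SUP_least)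
  fix p
  show "ereal (bracket p r) - k p \<le> ereal m"
    using assms(1)[of p] assms(2)[of p] by (cases "k p") auto
qed

lemma BC_functionD:
  assumes "BC_function k"
  shows "k p \<noteq> -\<infinity>" "\<exists>p s. k p \<le> ereal s" "convex_fun k" "ereal (qf p) \<le> k p" "k p \<le> fenchel_at k p"
proof -
  show "k p \<noteq> -\<infinity>" "convex_fun k" "ereal (qf p) \<le> k p" "k p \<le> fenchel_at k p"
    using assms unfolding BC_function_def proper_fun_def by blast+
  obtain p where "k p \<noteq> \<infinity>" "k p \<noteq> -\<infinity>"
    using assms by (auto simp: BC_function_def proper_fun_def)
  then show "\<exists>p s. k p \<le> ereal s"
    by (metis ereal_cases order_refl)
qed

text \<open>This identity serves twice: it gives nonnegativity over the origin in the duality step,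
  and it forces equality at the dual point.\<close>

lemma qf_split:
  "qf b + qf (rho1 (c - b)) = bracket b c - qf c"
  by (simp add: qf_def rho1_def bracket_def blinfun.bilinear_simps)

text \<open>The conclusion is the inequality for
  \<open>fenchel_at f a + fenchel_at g (rho1 (c - a))\<close>, spelled out on points of the two
  epigraphs to avoid extended arithmetic.\<close>

lemma BC_dual_point:
  fixes f g :: "'a::banach pd \<Rightarrow> ereal"
  assumes refl: "reflexive_space TYPE('a)"
    and f: "BC_function f" "lsc_fun f" and g: "BC_function g" "lsc_fun g"
    and dom: "msum (dom_fun f) (rho1 ` dom_fun g) = UNIV"
  obtains a where "\<And>b s d t. f b \<le> ereal s \<Longrightarrow> g d \<le> ereal t \<Longrightarrow>
    (bracket b a - s) + (bracket d (rho1 (c - a)) - t) \<le> bracket a c - qf c"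
proof -
  define T where "T y = fst y + rho1 (snd y)" for y :: "'a pd \<times> 'a pd"
  \<comment> \<open>\<open>h\<close> is linear, so \<open>K\<close> is a translated linear image of
    a product of epigraphs and thus convex.\<close>
  define h where "h w = (fst (fst w) + rho1 (fst (snd w)), snd (fst w) + snd (snd w) - bracket (fst (fst w)) c)"
    for w :: "('a pd \<times> real) \<times> ('a pd \<times> real)"
  \<comment> \<open>Over \<open>z\<close>, \<open>K\<close> holds the values above \<open>f b + g d - [b, c] + q c\<close> for \<open>b + \<rho>\<^sub>1 d - c = z\<close>.\<close>
  define K where "K = (\<lambda>x. (- c, qf c) + x) ` h ` ({(p, t). f p \<le> ereal t} \<times> {(p, t). g p \<le> ereal t})"
  \<comment> \<open>Both values and norms are cut off at \<open>n\<close>, which makes the sets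
    closed, convex and bounded, while the domain hypothesis makes their images under
    \<open>T\<close> cover the space.\<close>
  define S where "S n = ({b. f b \<le> ereal (real n)} \<inter> cball 0 (real n)) \<times> ({d. g d \<le> ereal (real n)} \<inter> cball 0 (real n))"
    for n
  have S_iff: "(b, d) \<in> S n \<longleftrightarrow> f b \<le> ereal n \<and> g d \<le> ereal n \<and> norm b \<le> n \<and> norm d \<le> n" for b d n
    by (auto simp: S_def)
  interpret br: bounded_linear "\<lambda>p. bracket p c" by (rule bounded_linear_bracket)
  interpret rho: bounded_linear "rho1 :: 'a pd \<Rightarrow> 'a pd" by (rule bounded_linear_rho1)
  have KI: "(b + rho1 d - c, s + t - bracket b c + qf c) \<in> K" if "f b \<le> ereal s" "g d \<le> ereal t" for b s d t
    unfolding K_def image_image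
    by (rule image_eqI[of _ _ "((b, s), (d, t))"]) (use that in \<open>simp_all add: h_def\<close>)
  have KE: "\<exists>b s d t. f b \<le> ereal s \<and> g d \<le> ereal t \<and> z = b + rho1 d - c \<and> r = s + t - bracket b c + qf c"
    if zr: "(z, r) \<in> K" for z r
  proof -
    obtain w where w: "(z, r) = (- c, qf c) + h w" "w \<in> {(p, t). f p \<le> ereal t} \<times> {(p, t). g p \<le> ereal t}"
      using zr unfolding K_def image_image by (rule imageE)
    obtain b s d t where "w = ((b, s), (d, t))" by (metis surj_pair)
    with w show ?thesis
      by (intro exI[of _ b] exI[of _ s] exI[of _ d] exI[of _ t]) (simp add: h_def)
  qed
  have cover: "\<exists>n. z \<in> T ` S n" for z
  proof -
    have "z \<in> msum (dom_fun f) (rho1 ` dom_fun g)" using dom by simp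
    then obtain b d s t where bd: "z = b + rho1 d" "f b = ereal s" "g d = ereal t"
      unfolding msum_def dom_fun_def by blast
    obtain n where n: "Max {s, t, norm b, norm d} \<le> real n"
      using real_arch_simple by blast
    then have "(b, d) \<in> S n"
      using bd by (simp add: S_iff)
    then show ?thesis using bd(1) by (intro exI image_eqI[of _ _ "(b, d)"]) (auto simp: T_def)
  qed
  have "linear h"
    by (rule linearI) (auto simp: h_def rho.add rho.scaleR br.add br.scaleR algebra_simps)
  then have "convex K"
    unfolding K_def using BC_functionD(3)[OF f(1)] BC_functionD(3)[OF g(1)]
    by (intro convex_translation convex_linear_image convex_Times) (auto simp: convex_fun_def)
  moreover have "\<exists>t. (z, t) \<in> K" for z
  proof -
    obtain n b d where "f b \<le> ereal (real n)" "g d \<le> ereal (real n)" "z + c = b + rho1 d"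
      using cover[of "z + c"] by (auto simp: T_def S_iff)
    with KI[of b n d n] show ?thesis by (metis add_diff_cancel_right')
  qed
  \<comment> \<open>Over the origin \<open>d\<close> is forced to be \<open>rho1 (c - b)\<close>, so
    \<open>qf_split\<close> and \<open>q\<close> below both functions give the sign.\<close>
  moreover have "0 \<le> r" if zr: "(0, r) \<in> K" for r
  proof -
    obtain b s d t where *: "f b \<le> ereal s" "g d \<le> ereal t" "0 = b + rho1 d - c" "r = s + t - bracket b c + qf c"
      using KE[OF zr] by blast
    have "d = rho1 (c - b)" using *(3) by (auto simp: rho1_def prod_eq_iff algebra_simps)
    moreover have "qf b \<le> s" "qf d \<le> t"
      using order_trans[OF BC_functionD(4)[OF f(1)] *(1)] order_trans[OF BC_functionD(4)[OF g(1)] *(2)] by auto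
    ultimately show ?thesis using qf_split[of b c] *(4) by simp
  qed
  ultimately obtain L where L: "linear L" and LK: "\<And>z t. (z, t) \<in> K \<Longrightarrow> L z \<le> t"
    using hahn_banach_convex[of K] by blast
  have "bounded_linear T"
    unfolding T_def by (intro bounded_linear_add bounded_linear_fst bounded_linear_compose[OF bounded_linear_rho1 bounded_linear_snd])
  moreover have "closed (S n)" for n
    unfolding S_def using f(2) g(2)
    by (intro closed_Times closed_Int closed_cball) (simp_all add: lsc_fun_def)
  moreover have "convex (S n)" for n
    unfolding S_def using BC_functionD(3)[OF f(1)] BC_functionD(3)[OF g(1)]
    by (intro convex_Times convex_Int convex_cball convex_fun_sublevel)
  moreover have "bounded (S n)" for n
    unfolding S_def by (intro bounded_Times bounded_Int disjI2 bounded_cball)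
  moreover have "(\<Union>n. T ` S n) = UNIV"
    using cover by (simp add: set_eq_iff)
  ultimately obtain n z r where r: "r > 0" and ball: "ball z r \<subseteq> T ` S n"
    using closed_convex_cover_ball[of T S] by metis
  obtain B where B: "\<And>b. norm (bracket b c) \<le> norm b * B" "B > 0"
    using br.pos_bounded by blast
  \<comment> \<open>Each point of the ball, shifted by \<open>- c\<close> as in \<open>K\<close>,
    comes from a pair in \<open>S n\<close>. There \<open>f\<close>, \<open>g\<close> and the norm
    of \<open>b\<close> are at most \<open>n\<close>, hence the value dominating \<open>L\<close> is
    bounded.\<close>
  have "bounded_linear L"
  proof (rule linear_bounded_above_on_ball[OF L r])
    fix w assume "w \<in> ball (z - c) r"
    then have "w + c \<in> ball z r" by (simp add: dist_norm algebra_simps)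
    then obtain b d where bd: "f b \<le> ereal n" "g d \<le> ereal n" "w + c = b + rho1 d" "norm b \<le> n"
      using subsetD[OF ball, of "w + c"] by (auto simp: T_def S_iff)
    have "L w \<le> real n + real n - bracket b c + qf c"
      using LK[OF KI[OF bd(1,2)]] bd(3) by (metis add_diff_cancel_right')
    moreover have "norm b * B \<le> real n * B"
      using bd(4) B(2) by simp
    then have "- bracket b c \<le> real n * B"
      using B(1)[of b] unfolding real_norm_def by linarith
    ultimately show "L w \<le> real n + real n + real n * B + qf c" by simp
  qed
  then obtain a' where a': "\<And>p. L p = bracket p a'"
    using reflexive_bracket_representation[OF refl] by blast
  \<comment> \<open>Absorbing the term \<open>bracket b c\<close> of \<open>K\<close> shifts
    \<open>a'\<close> to \<open>a = c + a'\<close>; moreover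
    \<open>bracket (rho1 d) a' = bracket d (rho1 (- a'))\<close>, and
    \<open>- a' = c - a\<close>.\<close>
  have "(bracket b (c + a') - s) + (bracket d (rho1 (c - (c + a'))) - t) \<le> bracket (c + a') c - qf c"
    if "f b \<le> ereal s" "g d \<le> ereal t" for b s d t
    using LK[OF KI[OF that]] unfolding a'
    by (simp add: bracket_def rho1_def qf_def blinfun.bilinear_simps)
  then show thesis by (rule that)
qed

section \<open>Equality at the dual point\<close>

lemma Pq_decomposition:
  fixes f g :: "'a::banach pd \<Rightarrow> ereal"
  assumes refl: "reflexive_space TYPE('a)"
    and f: "BC_function f" "lsc_fun f" and g: "BC_function g" "lsc_fun g"
    and dom: "msum (dom_fun f) (rho1 ` dom_fun g) = UNIV"
  shows "c \<in> msum (Pq f) (rho1 ` Pq g)"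
proof -
  obtain a where a: "\<And>b s d t. f b \<le> ereal s \<Longrightarrow> g d \<le> ereal t \<Longrightarrow>
    (bracket b a - s) + (bracket d (rho1 (c - a)) - t) \<le> bracket a c - qf c"
    using BC_dual_point[OF refl f g dom] by blast
  define e where "e = rho1 (c - a)"
  \<comment> \<open>The two suprema are taken in turn: first over \<open>b\<close>, with
    \<open>d\<close> and \<open>t\<close> fixed.\<close>
  have fa: "f a \<le> ereal (bracket a c - qf c - (bracket d e - t))" if "g d \<le> ereal t" for d t
    by (rule order_trans[OF BC_functionD(5)[OF f(1)] fenchel_at_le])
      (use a[OF _ that] BC_functionD(1)[OF f(1)] in \<open>force simp: e_def algebra_simps\<close>)+
  obtain d0 t0 where "g d0 \<le> ereal t0" using BC_functionD(2)[OF g(1)] by blast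
  from fa[OF this] obtain \<alpha> where \<alpha>: "f a = ereal \<alpha>"
    using BC_functionD(1)[OF f(1), of a] by (cases "f a") auto
  \<comment> \<open>With \<open>f a\<close> now known to be real, \<open>fa\<close> rearranges to a
    bound for every \<open>d\<close> and \<open>t\<close>, which is the supremum for
    \<open>g\<close>.\<close>
  have "g e \<le> ereal (bracket a c - qf c - \<alpha>)"
    by (rule order_trans[OF BC_functionD(5)[OF g(1)] fenchel_at_le])
      (use fa BC_functionD(1)[OF g(1)] in \<open>force simp: \<alpha> algebra_simps\<close>)+
  moreover have "qf a \<le> \<alpha>" using BC_functionD(4)[OF f(1), of a] by (simp add: \<alpha>)
  moreover have "ereal (qf e) \<le> g e" by (rule BC_functionD(4)[OF g(1)])
  moreover have "qf a + qf e = bracket a c - qf c" unfolding e_def by (rule qf_split)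
  \<comment> \<open>The gaps \<open>f a - qf a\<close> and \<open>g e - qf e\<close> are nonnegative
    with sum at most 0.\<close>
  ultimately have "f a = ereal (qf a)" "g e = ereal (qf e)"
    by (cases "g e"; simp add: \<alpha>)+
  moreover have "c = a + rho1 e" by (simp add: e_def rho1_def prod_eq_iff)
  ultimately show ?thesis unfolding msum_def Pq_def by blast
qed

lemma dom_sum_iff_Pq_sum:
  fixes f g :: "'a::banach pd \<Rightarrow> ereal"
  assumes "reflexive_space TYPE('a)"
    and "BC_function f" "lsc_fun f" and "BC_function g" "lsc_fun g"
  shows "msum (dom_fun f) (rho1 ` dom_fun g) = UNIV \<longleftrightarrow> msum (Pq f) (rho1 ` Pq g) = UNIV"
proof
  assume "msum (Pq f) (rho1 ` Pq g) = UNIV"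
  moreover have "msum (Pq f) (rho1 ` Pq g) \<subseteq> msum (dom_fun f) (rho1 ` dom_fun g)"
    unfolding msum_def Pq_def dom_fun_def by blast
  ultimately show "msum (dom_fun f) (rho1 ` dom_fun g) = UNIV" by blast
qed (use Pq_decomposition[OF assms] in blast)

section \<open>Reflection and the statement for differences\<close>

text \<open>The bracket is unchanged when both arguments change sign and \<open>q\<close> is even,
  so conjugation commutes with the reflection.\<close>

lemma BC_function_reflect:
  fixes k :: "'a::real_normed_vector pd \<Rightarrow> ereal"
  assumes "BC_function k"
  shows "BC_function (\<lambda>p. k (- p))"
proof -
  have neg: "range (uminus :: 'a pd \<Rightarrow> 'a pd) = UNIV" by simp
  have "fenchel_at (\<lambda>p. k (- p)) r = fenchel_at k (- r)" for r
  proof -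
    have "fenchel_at k (- r) = (SUP p\<in>range uminus. ereal (bracket p (- r)) - k p)"
      by (simp only: fenchel_at_def neg)
    also have "\<dots> = (SUP p. ereal (bracket (- p) (- r)) - k (- p))"
      by (simp only: image_image)
    also have "\<dots> = fenchel_at (\<lambda>p. k (- p)) r"
      by (simp add: fenchel_at_def bracket_def blinfun.bilinear_simps)
    finally show ?thesis ..
  qed
  moreover have "convex_fun (\<lambda>p. k (- p))"
  proof -
    have "linear (\<lambda>w :: 'a pd \<times> real. (- fst w, snd w))"
      by (rule linearI) auto
    then have "convex ((\<lambda>w. (- fst w, snd w)) -` {(p, t). k p \<le> ereal t})"
      using BC_functionD(3)[OF assms] unfolding convex_fun_def by (rule convex_linear_vimage)
    moreover have "(\<lambda>w. (- fst w, snd w)) -` {(p, t). k p \<le> ereal t} = {(p, t). k (- p) \<le> ereal t}"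
      by auto
    ultimately show ?thesis by (simp add: convex_fun_def)
  qed
  moreover have "qf (- p) = qf p" for p :: "'a pd"
    by (simp add: qf_def blinfun.bilinear_simps)
  ultimately show ?thesis
    using assms unfolding BC_function_def proper_fun_def by (metis minus_minus)
qed

lemma lsc_fun_reflect:
  fixes k :: "'b::real_normed_vector \<Rightarrow> ereal"
  assumes "lsc_fun k"
  shows "lsc_fun (\<lambda>p. k (- p))"
  unfolding lsc_fun_def
proof
  fix c :: real
  have "{p. k (- p) \<le> ereal c} = uminus ` {p. k p \<le> ereal c}"
    by (force intro: image_eqI[of _ _ "- _"])
  then show "closed {p. k (- p) \<le> ereal c}"
    using assms closed_negations by (auto simp: lsc_fun_def)
qed

text \<open>\<open>rho1\<close> is odd, so a minus sign moves into its argument. The set-builder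
  form lets the lemma apply to domains and coincidence sets alike.\<close>

lemma mdiff_rho1_eq_msum:
  "mdiff A (rho1 ` {p. P p}) = msum A (rho1 ` {p. P (- p)})"
proof -
  have neg: "rho1 (- p) = - rho1 p" for p :: "'a pd" by (simp add: rho1_def)
  show ?thesis
  proof (intro set_eqI iffI)
    fix x assume "x \<in> mdiff A (rho1 ` {p. P p})"
    then obtain a d where "x = a - rho1 d" "a \<in> A" "P d" unfolding mdiff_def by blast
    then have "x = a + rho1 (- d)" "a \<in> A" "P (- (- d))" by (simp_all add: neg)
    then show "x \<in> msum A (rho1 ` {p. P (- p)})" unfolding msum_def by blast
  next
    fix x assume "x \<in> msum A (rho1 ` {p. P (- p)})"
    then obtain a d where "x = a + rho1 d" "a \<in> A" "P (- d)" unfolding msum_def by blast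
    then have "x = a - rho1 (- d)" "a \<in> A" "P (- d)" by (simp_all add: neg)
    then show "x \<in> mdiff A (rho1 ` {p. P p})" unfolding mdiff_def by blast
  qed
qed

theorem theorem7p1:
  fixes f g :: "('a::banach \<times> ('a \<Rightarrow>\<^sub>L real)) \<Rightarrow> ereal"
  assumes "reflexive_space TYPE('a)"
    and "\<exists>x::'a. x \<noteq> 0"
    and "proper_fun f" and "convex_fun f" and "lsc_fun f" and "BC_function f"
    and "proper_fun g" and "convex_fun g" and "lsc_fun g" and "BC_function g"
  shows "(msum (dom_fun f) (rho1 ` dom_fun g) = UNIV \<longleftrightarrow> msum (Pq f) (rho1 ` Pq g) = UNIV)
       \<and> (mdiff (dom_fun f) (rho1 ` dom_fun g) = UNIV \<longleftrightarrow> mdiff (Pq f) (rho1 ` Pq g) = UNIV)"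
proof
  show "msum (dom_fun f) (rho1 ` dom_fun g) = UNIV \<longleftrightarrow> msum (Pq f) (rho1 ` Pq g) = UNIV"
    using assms by (intro dom_sum_iff_Pq_sum)
  have "mdiff (dom_fun f) (rho1 ` dom_fun g) = msum (dom_fun f) (rho1 ` dom_fun (\<lambda>p. g (- p)))"
    unfolding dom_fun_def[of g] dom_fun_def[of "\<lambda>p. g (- p)"] by (rule mdiff_rho1_eq_msum)
  \<comment> \<open>As \<open>q\<close> is even, the condition can be written wholly in terms of
    \<open>- p\<close>, the shape that \<open>mdiff_rho1_eq_msum\<close> expects.\<close>
  moreover have "Pq (\<lambda>p. g (- p)) = {p. g (- p) = ereal (qf (- p))}"
    by (simp add: Pq_def qf_def blinfun.bilinear_simps)
  then have "mdiff (Pq f) (rho1 ` Pq g) = msum (Pq f) (rho1 ` Pq (\<lambda>p. g (- p)))"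
    unfolding Pq_def[of g] by (simp add: mdiff_rho1_eq_msum)
  ultimately show "mdiff (dom_fun f) (rho1 ` dom_fun g) = UNIV \<longleftrightarrow> mdiff (Pq f) (rho1 ` Pq g) = UNIV"
    using dom_sum_iff_Pq_sum[of f "\<lambda>p. g (- p)"] BC_function_reflect[of g] lsc_fun_reflect[of g] assms
    by simp
qed

end
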